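(* Let $n\ge 2$ and let $G$ be the Shephard group $B_n(2,\infty)$, with standard generating set $S=\{a_0,a_1,\dots,a_{n-1}\}$. Then, for all $J,K,L\subseteq S$: (a) $\langle J\rangle\cap\langle K\rangle=\langle J\cap K\rangle$; (b) $\langle J\rangle\langle K\rangle\cap\langle J\rangle\langle L\rangle=\langle J\rangle(\langle K\rangle\cap\langle L\rangle)$; (c) the simplicial complex $\mathcal K(G,(G_i)_{i\in I})$ is a flag complex, where $I=\{0,\dots,n-1\}$ and $G_i=\langle a_j\mid j\in I\setminus\{i\}\rangle$.
   Context: $B_n(2,\infty)$ is the group with generators $a_0,a_1,\dots,a_{n-1}$ and relations $a_0^2=1$; $a_0a_1a_0a_1=a_1a_0a_1a_0$; $a_ja_{j+1}a_j=a_{j+1}a_ja_{j+1}$ for $1\le j\le n-2$; $a_ia_j=a_ja_i$ for $|i-j|\ge 2$ (so no relation is imposed on the order of $a_1,\dots,a_{n-1}$). Products such as $\langle J\rangle\langle K\rangle$ are sets of products of elements. The coset complex $\mathcal K(G,(G_i)_{i\in I})$ is the abstract simplicial complex with vertices the left cosets $gG_i$, $g\in G$, $i\in I$ (cosets of different types $i$ are different vertices), a set $\{g_1G_{i_1},\dots,g_mG_{i_m}\}$ of vertices being a simplex iff $g_1G_{i_1}\cap\dots\cap g_mG_{i_m}\neq\emptyset$. A simplicial complex is a flag complex if every set of vertices that are pairwise joined by edges is a simplex. *)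

theory Defs
  imports "HOL-Algebra.Coset" "HOL-Algebra.Generated_Groups"
begin

section \<open>Groups given by generators and relations\<close>

text \<open>
  The letter \<open>(x, True)\<close> stands for the generator \<open>x\<close>, the letter \<open>(x, False)\<close>
  for its formal inverse. A relation \<open>u = v\<close> is the pair \<open>(u, v)\<close> of words.
\<close>

type_synonym 'a word = "('a \<times> bool) list"

definition words :: "'a set \<Rightarrow> 'a word set" where
  "words X = lists (X \<times> UNIV)"

inductive_set pres_rel :: "'a set \<Rightarrow> ('a word \<times> 'a word) set \<Rightarrow> ('a word \<times> 'a word) set"
  for X :: "'a set" and R :: "('a word \<times> 'a word) set"
where
  rel: "(u, v) \<in> R \<Longrightarrow> u \<in> words X \<Longrightarrow> v \<in> words X \<Longrightarrow> (u, v) \<in> pres_rel X R"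
| cancel: "x \<in> X \<Longrightarrow> ([(x, b), (x, \<not> b)], []) \<in> pres_rel X R"
| cong: "(u, u') \<in> pres_rel X R \<Longrightarrow> (v, v') \<in> pres_rel X R \<Longrightarrow> (u @ v, u' @ v') \<in> pres_rel X R"
| refl: "u \<in> words X \<Longrightarrow> (u, u) \<in> pres_rel X R"
| sym: "(u, v) \<in> pres_rel X R \<Longrightarrow> (v, u) \<in> pres_rel X R"
| trans: "(u, v) \<in> pres_rel X R \<Longrightarrow> (v, w) \<in> pres_rel X R \<Longrightarrow> (u, w) \<in> pres_rel X R"

definition presented_group :: "'a set \<Rightarrow> ('a word \<times> 'a word) set \<Rightarrow> 'a word set monoid" where
  "presented_group X R =
     \<lparr>carrier = words X // pres_rel X R,
      mult = (\<lambda>A B. \<Union>u\<in>A. \<Union>v\<in>B. pres_rel X R `` {u @ v}),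
      one = pres_rel X R `` {[]}\<rparr>"

definition pres_gen :: "'a set \<Rightarrow> ('a word \<times> 'a word) set \<Rightarrow> 'a \<Rightarrow> 'a word set" where
  "pres_gen X R x = pres_rel X R `` {[(x, True)]}"

lemma words_simps [simp]:
  "[] \<in> words X" "a # w \<in> words X \<longleftrightarrow> fst a \<in> X \<and> w \<in> words X"
  "u @ v \<in> words X \<longleftrightarrow> u \<in> words X \<and> v \<in> words X"
  by (auto simp: words_def mem_Times_iff)

lemma pres_rel_words: "(u, v) \<in> pres_rel X R \<Longrightarrow> u \<in> words X \<and> v \<in> words X"
  by (induction rule: pres_rel.induct) auto

lemma equiv_pres_rel: "equiv (words X) (pres_rel X R)"
proof (rule equivI)
  show "refl_on (words X) (pres_rel X R)"
    by (auto simp: refl_on_def intro: pres_rel.refl)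
  show "pres_rel X R \<subseteq> words X \<times> words X"
    using pres_rel_words by fast
  show "sym (pres_rel X R)"
    by (rule symI) (rule pres_rel.sym)
  show "trans (pres_rel X R)"
    by (rule transI) (rule pres_rel.trans)
qed

lemma pres_mult:
  assumes "u \<in> words X" "v \<in> words X"
  shows "pres_rel X R `` {u} \<otimes>\<^bsub>presented_group X R\<^esub> pres_rel X R `` {v} = pres_rel X R `` {u @ v}"
proof -
  let ?C = "pres_rel X R `` {u @ v}"
  have *: "pres_rel X R `` {u' @ v'} = ?C"
    if "u' \<in> pres_rel X R `` {u}" "v' \<in> pres_rel X R `` {v}" for u' v'
  proof -
    have "(u @ v, u' @ v') \<in> pres_rel X R"
      by (rule pres_rel.cong) (use that in blast)+
    from equiv_class_eq[OF equiv_pres_rel this] show ?thesis by (rule HOL.sym)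
  qed
  have "u \<in> pres_rel X R `` {u}" "v \<in> pres_rel X R `` {v}"
    using assms pres_rel.refl by blast+
  then have "(\<Union>u'\<in>pres_rel X R `` {u}. \<Union>v'\<in>pres_rel X R `` {v}. pres_rel X R `` {u' @ v'}) = ?C"
    using * by blast
  then show ?thesis by (simp add: presented_group_def)
qed

lemma pres_class_cases:
  assumes "A \<in> carrier (presented_group X R)"
  obtains w where "w \<in> words X" "A = pres_rel X R `` {w}"
  using assms by (auto simp: presented_group_def quotient_def)

lemma pres_class_carrier: "w \<in> words X \<Longrightarrow> pres_rel X R `` {w} \<in> carrier (presented_group X R)"
  by (auto simp: presented_group_def quotient_def)

lemma pres_one: "\<one>\<^bsub>presented_group X R\<^esub> = pres_rel X R `` {[]}"
  by (simp add: presented_group_def)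

lemma pres_rel_inverse:
  "w \<in> words X \<Longrightarrow> (rev (map (\<lambda>(x, b). (x, \<not> b)) w) @ w, []) \<in> pres_rel X R"
proof (induction w)
  case Nil
  then show ?case by (auto intro: pres_rel.refl)
next
  case (Cons a w)
  obtain x b where a: "a = (x, b)" by (cases a)
  let ?i = "rev (map (\<lambda>(x, b). (x, \<not> b)) w)"
  have x: "x \<in> X" and w: "w \<in> words X" using Cons.prems a by auto
  have IH: "(?i @ w, []) \<in> pres_rel X R" using Cons.IH w by simp
  then have i: "?i \<in> words X" using pres_rel_words[OF IH] by simp
  have "([(x, \<not> b), (x, \<not> \<not> b)] @ w, [] @ w) \<in> pres_rel X R"
    by (rule pres_rel.cong[OF pres_rel.cancel[OF x] pres_rel.refl[OF w]])
  from pres_rel.trans[OF pres_rel.cong[OF pres_rel.refl[OF i] this]] IH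
  show ?case using a by simp
qed

lemma group_presented_group: "group (presented_group X R)"
proof (rule groupI, goal_cases)
  case (1 A B)
  then show ?case by (elim pres_class_cases) (simp add: pres_mult pres_class_carrier)
next
  case 2
  show ?case by (simp add: pres_one pres_class_carrier)
next
  case (3 A B C)
  then show ?case by (elim pres_class_cases) (simp add: pres_mult)
next
  case (4 A)
  then show ?case by (elim pres_class_cases) (simp add: pres_mult pres_one)
next
  case (5 A)
  then obtain w where w: "w \<in> words X" "A = pres_rel X R `` {w}" by (rule pres_class_cases)
  let ?i = "rev (map (\<lambda>(x, b). (x, \<not> b)) w)"
  have *: "(?i @ w, []) \<in> pres_rel X R" using pres_rel_inverse w by blast
  then have i: "?i \<in> words X" using pres_rel_words[OF *] by simp
  have "pres_rel X R `` {?i} \<otimes>\<^bsub>presented_group X R\<^esub> A = \<one>\<^bsub>presented_group X R\<^esub>"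
    using equiv_class_eq[OF equiv_pres_rel *] i w by (simp add: pres_mult pres_one)
  then show ?case using pres_class_carrier[OF i] by blast
qed

fun word_eval :: "('b, 'c) monoid_scheme \<Rightarrow> ('a \<Rightarrow> 'b) \<Rightarrow> 'a word \<Rightarrow> 'b" where
  "word_eval H f [] = \<one>\<^bsub>H\<^esub>"
| "word_eval H f ((x, b) # w) = (if b then f x else inv\<^bsub>H\<^esub> f x) \<otimes>\<^bsub>H\<^esub> word_eval H f w"

lemma word_eval_pres_gen:
  "w \<in> words X \<Longrightarrow> word_eval (presented_group X R) (pres_gen X R) w = pres_rel X R `` {w}"
proof (induction w)
  case Nil
  then show ?case by (simp add: pres_one)
next
  case (Cons a w)
  interpret G: group "presented_group X R" by (rule group_presented_group)
  obtain x b where a: "a = (x, b)" by (cases a)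
  have x: "x \<in> X" and w: "w \<in> words X" using Cons.prems a by auto
  have "inv\<^bsub>presented_group X R\<^esub> pres_gen X R x = pres_rel X R `` {[(x, False)]}"
  proof (rule G.inv_equality)
    show "pres_rel X R `` {[(x, False)]} \<otimes>\<^bsub>presented_group X R\<^esub> pres_gen X R x
        = \<one>\<^bsub>presented_group X R\<^esub>"
      using equiv_class_eq[OF equiv_pres_rel pres_rel.cancel[OF x, of False]] x
      by (simp add: pres_gen_def pres_mult pres_one)
  qed (use x in \<open>auto simp: pres_gen_def intro: pres_class_carrier\<close>)
  then have "(if b then pres_gen X R x else inv\<^bsub>presented_group X R\<^esub> pres_gen X R x)
      = pres_rel X R `` {[(x, b)]}"
    by (simp add: pres_gen_def)
  then show ?case using Cons.IH a x w by (simp add: pres_mult)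
qed

lemma presented_group_relation:
  assumes "(u, v) \<in> R" "u \<in> words X" "v \<in> words X"
  shows "word_eval (presented_group X R) (pres_gen X R) u
       = word_eval (presented_group X R) (pres_gen X R) v"
  using assms equiv_class_eq[OF equiv_pres_rel pres_rel.rel[OF assms]]
  by (simp add: word_eval_pres_gen)

lemma generate_presented_group:
  "generate (presented_group X R) (pres_gen X R ` X) = carrier (presented_group X R)"
proof
  interpret G: group "presented_group X R" by (rule group_presented_group)
  show "generate (presented_group X R) (pres_gen X R ` X) \<subseteq> carrier (presented_group X R)"
    by (rule G.generate_incl) (auto simp: pres_gen_def intro: pres_class_carrier)
  have "word_eval (presented_group X R) (pres_gen X R) w
      \<in> generate (presented_group X R) (pres_gen X R ` X)" if "w \<in> words X" for w
    using that
  proof (induction w)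
    case (Cons a w)
    then show ?case
      by (cases a) (auto intro: generate.eng generate.incl generate.inv)
  qed (simp add: generate.one)
  then show "carrier (presented_group X R) \<subseteq> generate (presented_group X R) (pres_gen X R ` X)"
    by (auto elim!: pres_class_cases simp flip: word_eval_pres_gen)
qed

lemma presented_group_universal:
  assumes "group H" and f: "f \<in> X \<rightarrow> carrier H"
    and R: "\<And>u v. (u, v) \<in> R \<Longrightarrow> u \<in> words X \<Longrightarrow> v \<in> words X \<Longrightarrow> word_eval H f u = word_eval H f v"
  shows "\<exists>h \<in> hom (presented_group X R) H. \<forall>x\<in>X. h (pres_gen X R x) = f x"
proof -
  interpret H: group H by fact
  have c: "word_eval H f w \<in> carrier H" if "w \<in> words X" for w
    using that
  proof (induction w)
    case (Cons a w)
    then show ?case using f by (cases a) auto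
  qed simp
  have app: "word_eval H f (u @ v) = word_eval H f u \<otimes>\<^bsub>H\<^esub> word_eval H f v"
    if "u \<in> words X" "v \<in> words X" for u v
    using that(1)
  proof (induction u)
    case (Cons a u)
    obtain x b where a: "a = (x, b)" by (cases a)
    have "f x \<in> carrier H" using Cons a f by auto
    then show ?case using Cons a c[of u] c[OF that(2)] by (simp add: H.m_assoc)
  qed (use c that in simp)
  have eq: "word_eval H f u = word_eval H f v" if "(u, v) \<in> pres_rel X R" for u v
    using that
  proof (induction rule: pres_rel.induct)
    case (cancel x b)
    then have "f x \<in> carrier H" using f by auto
    then show ?case by simp
  next
    case (cong u u' v v')
    then show ?case
      using app[of u v] app[of u' v'] pres_rel_words[OF cong.hyps(1)] pres_rel_words[OF cong.hyps(2)]
      by simp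
  next
    case (rel u v)
    then show ?case by (rule R)
  qed simp_all
  define h where "h A = word_eval H f (SOME w. w \<in> A)" for A
  have h: "h (pres_rel X R `` {w}) = word_eval H f w" if "w \<in> words X" for w
  proof -
    have "w \<in> pres_rel X R `` {w}" using that by (auto intro: pres_rel.refl)
    then have "(SOME w'. w' \<in> pres_rel X R `` {w}) \<in> pres_rel X R `` {w}" by (rule someI)
    then have "(w, SOME w'. w' \<in> pres_rel X R `` {w}) \<in> pres_rel X R" by blast
    from eq[OF this] show ?thesis by (simp add: h_def)
  qed
  have "h \<in> hom (presented_group X R) H"
  proof (rule homI)
    fix A assume "A \<in> carrier (presented_group X R)"
    then show "h A \<in> carrier H" by (elim pres_class_cases) (simp add: h c)
  next
    fix A B assume "A \<in> carrier (presented_group X R)" "B \<in> carrier (presented_group X R)"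
    then show "h (A \<otimes>\<^bsub>presented_group X R\<^esub> B) = h A \<otimes>\<^bsub>H\<^esub> h B"
      by (elim pres_class_cases) (simp add: h app pres_mult)
  qed
  moreover have "h (pres_gen X R x) = f x" if "x \<in> X" for x
    using that funcset_mem[OF f that] by (simp add: pres_gen_def h)
  ultimately show ?thesis by blast
qed


section \<open>The Shephard group of type B with parameters 2 and infinity\<close>

abbreviation gen :: "nat \<Rightarrow> nat \<times> bool" where
  "gen i \<equiv> (i, True)"

definition shephard_rels :: "nat \<Rightarrow> (nat word \<times> nat word) set" where
  "shephard_rels n =
     {([gen 0, gen 0], [])}
   \<union> {([gen 0, gen 1, gen 0, gen 1], [gen 1, gen 0, gen 1, gen 0])}
   \<union> {([gen j, gen (j + 1), gen j], [gen (j + 1), gen j, gen (j + 1)]) | j. 1 \<le> j \<and> j + 2 \<le> n}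
   \<union> {([gen i, gen j], [gen j, gen i]) | i j. i < n \<and> j < n \<and> \<bar>int i - int j\<bar> \<ge> 2}"

definition shephard_B2inf :: "nat \<Rightarrow> nat word set monoid" where
  "shephard_B2inf n = presented_group {..<n} (shephard_rels n)"

definition shephard_gen :: "nat \<Rightarrow> nat \<Rightarrow> nat word set" where
  "shephard_gen n = pres_gen {..<n} (shephard_rels n)"


section \<open>Coset complexes and flag complexes\<close>

text \<open>
  An abstract simplicial complex is represented by the set of its simplices, which are nonempty
  finite sets of vertices; the vertex set is their union.
\<close>

definition flag_complex :: "'v set set \<Rightarrow> bool" where
  "flag_complex K \<longleftrightarrow>
     (\<forall>\<sigma>. \<sigma> \<noteq> {} \<and> \<sigma> \<subseteq> \<Union>K \<and> pairwise (\<lambda>x y. {x, y} \<in> K) \<sigma> \<longrightarrow> \<sigma> \<in> K)"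

text \<open>
  The coset \<open>g H\<^sub>i\<close> is tagged with its type \<open>i\<close>, so that cosets of different types
  are different vertices even if they coincide as subsets of the group.
\<close>

definition coset_vertices ::
    "('g, 'm) monoid_scheme \<Rightarrow> ('i \<Rightarrow> 'g set) \<Rightarrow> 'i set \<Rightarrow> ('i \<times> 'g set) set" where
  "coset_vertices G H I = {(i, g <#\<^bsub>G\<^esub> H i) | i g. i \<in> I \<and> g \<in> carrier G}"

definition coset_complex ::
    "('g, 'm) monoid_scheme \<Rightarrow> ('i \<Rightarrow> 'g set) \<Rightarrow> 'i set \<Rightarrow> ('i \<times> 'g set) set set" where
  "coset_complex G H I =
     {\<sigma>. finite \<sigma> \<and> \<sigma> \<noteq> {} \<and> \<sigma> \<subseteq> coset_vertices G H I \<and> (\<Inter>v\<in>\<sigma>. snd v) \<noteq> {}}"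

lemma Union_coset_complex:
  assumes "group G" "\<And>i. i \<in> I \<Longrightarrow> subgroup (H i) G"
  shows "\<Union>(coset_complex G H I) = coset_vertices G H I"
proof
  show "coset_vertices G H I \<subseteq> \<Union>(coset_complex G H I)"
  proof
    fix v assume v: "v \<in> coset_vertices G H I"
    then have "snd v \<noteq> {}"
      using assms subgroup.one_closed by (fastforce simp: coset_vertices_def l_coset_def)
    then have "{v} \<in> coset_complex G H I" using v by (simp add: coset_complex_def)
    then show "v \<in> \<Union>(coset_complex G H I)" by blast
  qed
qed (auto simp: coset_complex_def)

end

theory Submission
  imports Defs
begin

text \<open>
  Everything follows from maps \<open>r : G \<rightarrow> \<langle>J\<rangle>\<close>, one for each \<open>J \<subseteq> S\<close>, that commute with left
  multiplication by \<open>\<langle>J\<rangle>\<close> and send \<open>\<langle>L\<rangle>\<close> into \<open>\<langle>L \<inter> J\<rangle>\<close> for every \<open>L\<close>. If \<open>k = y l\<close> with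
  \<open>y \<in> \<langle>J\<rangle>\<close>, \<open>k \<in> \<langle>K\<rangle>\<close>, \<open>l \<in> \<langle>L\<rangle>\<close>, then \<open>r k = y (r l)\<close>, and \<open>m = (r k)\<^sup>-\<^sup>1 k = (r l)\<^sup>-\<^sup>1 l\<close>
  lies in \<open>\<langle>K\<rangle> \<inter> \<langle>L\<rangle>\<close>. This gives (b), and it says that three pairwise intersecting cosets
  of standard parabolic subgroups have a common point; (c) is then a Helly argument.

  Such maps compose, so it suffices to treat \<open>J = S - {a\<^sub>k}\<close>. Let the Coxeter group of type B act
  on vectors with entries in \<open>{-1, 0, 1}\<close> by permuting entries and changing signs. The vector
  \<open>(0, \<dots>, 0, 1, \<dots>, 1)\<close> with \<open>k\<close> zeros has stabiliser \<open>W\<^sub>J\<close>, so its orbit is the set of cosets \<open>W\<^sub>J w\<close>. While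
  reading a word, follow this vector; a letter that moves the vector is deleted, and a letter
  \<open>s\<close> that fixes it is replaced by \<open>w s w\<^sup>-\<^sup>1 \<in> J\<close>, where \<open>w\<close> is the shortest representative of
  the current coset. This is the retraction of Charney, Paris and Godelle for Artin groups;
  it also respects \<open>a\<^sub>0\<^sup>2 = 1\<close>.
\<close>

section \<open>The automaton\<close>

definition count_zero :: "int list \<Rightarrow> nat" where
  "count_zero x = length (filter (\<lambda>p. p = 0) x)"

definition count_nonpos :: "int list \<Rightarrow> nat" where
  "count_nonpos x = length (filter (\<lambda>p. p \<le> 0) x)"

lemma count_simps [simp]:
  "count_zero [] = 0" "count_zero (p # x) = (if p = 0 then Suc (count_zero x) else count_zero x)"
  "count_zero (x @ y) = count_zero x + count_zero y"
  "count_nonpos [] = 0" "count_nonpos (p # x) = (if p \<le> 0 then Suc (count_nonpos x) else count_nonpos x)"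
  "count_nonpos (x @ y) = count_nonpos x + count_nonpos y"
  by (simp_all add: count_zero_def count_nonpos_def)

lemma count_le: "count_zero x \<le> count_nonpos x" "count_nonpos x \<le> length x" "count_zero x \<le> length x"
  by (induction x) auto

text \<open>
  The index of \<open>w s w\<^sup>-\<^sup>1\<close> when \<open>s\<close> swaps the two equal entries in \<open>A @ p # p # B\<close>. Extend the
  vector \<open>x\<close> antisymmetrically by \<open>x\<^sub>-\<^sub>i = - x\<^sub>i\<close>; then \<open>w\<close> numbers the occurrences of each value
  from left to right. Hence an entry \<open>1\<close> is preceded by the mirror images of all entries \<open>-1\<close>,
  and the entries \<open>-1\<close> are numbered from right to left. The numbering of the nonzero entries
  starts after the \<open>k\<close> zeros, which is why zeros of both \<open>A\<close> and \<open>B\<close> are counted.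
\<close>

fun block_gen :: "int list \<Rightarrow> int \<Rightarrow> int list \<Rightarrow> nat" where
  "block_gen A p B =
     (if p = 0 then Suc (count_zero A)
      else if p = 1 then Suc (length A + count_nonpos B)
      else Suc (count_zero A + count_nonpos B))"

fun next_state :: "int list \<Rightarrow> nat \<Rightarrow> int list" where
  "next_state x 0 = (case x of [] \<Rightarrow> [] | p # y \<Rightarrow> - p # y)"
| "next_state x (Suc i) = x[i := x ! Suc i, Suc i := x ! i]"

fun emit :: "int list \<Rightarrow> nat \<Rightarrow> nat list" where
  "emit x 0 = (if x ! 0 = 0 then [0] else [])"
| "emit x (Suc i) =
     (if x ! i = x ! Suc i then [block_gen (take i x) (x ! i) (drop (Suc (Suc i)) x)] else [])"

text \<open>The sign of a letter is ignored, since every generator acts on vectors as an involution;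
  \<open>run\<close> copies the sign to the output.\<close>

fun final_state :: "int list \<Rightarrow> nat word \<Rightarrow> int list" where
  "final_state x [] = x"
| "final_state x ((i, b) # w) = final_state (next_state x i) w"

fun run :: "int list \<Rightarrow> nat word \<Rightarrow> nat word" where
  "run x [] = []"
| "run x ((i, b) # w) = map (\<lambda>j. (j, b)) (emit x i) @ run (next_state x i) w"

lemma final_state_append: "final_state x (u @ v) = final_state (final_state x u) v"
  by (induction x u rule: final_state.induct) auto

lemma run_append: "run x (u @ v) = run x u @ run (final_state x u) v"
  by (induction x u rule: run.induct) auto

definition states :: "nat \<Rightarrow> int list set" where
  "states n = {x. length x = n \<and> set x \<subseteq> {-1, 0, 1}}"

lemma split_two:
  assumes "Suc i < length x"
  shows "\<exists>A p q B. length A = i \<and> x = A @ p # q # B"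
  using assms by (metis Cons_nth_drop_Suc Suc_lessD append_take_drop_id length_take min.absorb4)

lemma split_three:
  assumes "Suc (Suc i) < length x"
  shows "\<exists>A p q r B. length A = i \<and> x = A @ p # q # r # B"
proof -
  obtain A p q B where *: "length A = i" "x = A @ p # q # B"
    using split_two[of i x] assms by auto
  then obtain r B' where "B = r # B'" using assms by (cases B) auto
  then show ?thesis using * by blast
qed

lemma next_swap: "next_state (A @ p # q # B) (Suc (length A)) = A @ q # p # B"
  by (simp add: nth_append list_update_append)

lemma emit_swap:
  "emit (A @ p # q # B) (Suc (length A)) = (if p = q then [block_gen A p B] else [])"
  by (simp add: nth_append)

lemma next_flip [simp]: "next_state (p # x) 0 = - p # x"
  by simp

lemma emit_flip [simp]: "emit (p # x) 0 = (if p = 0 then [0] else [])"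
  by simp

declare next_state.simps [simp del] emit.simps [simp del]

text \<open>Simplification nests appends to the right and turns lengths into sums, so
  \<open>next_swap\<close> and \<open>emit_swap\<close> no longer match at later positions. These
  instances have the simplified shape.\<close>

lemmas swap_after_one = next_swap[of "A @ [a]" for A a, simplified]
  emit_swap[of "A @ [a]" for A a, simplified]
lemmas swap_after_tail = next_swap[of "a # B" for a B, simplified]
  emit_swap[of "a # B" for a B, simplified]
lemmas swap_after_two = next_swap[of "A @ a # b # B" for A a b B, simplified]
  emit_swap[of "A @ a # b # B" for A a b B, simplified]

declare next_swap [simp] emit_swap [simp]

lemma next_state_states:
  assumes "x \<in> states n" "i < n"
  shows "next_state x i \<in> states n"
proof (cases i)
  case 0
  then show ?thesis using assms by (cases x) (auto simp: states_def)
next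
  case (Suc j)
  then obtain A p q B where "length A = j" "x = A @ p # q # B"
    using assms split_two[of j x] by (auto simp: states_def)
  then show ?thesis using assms Suc by (auto simp: states_def)
qed

lemma final_state_states:
  "x \<in> states n \<Longrightarrow> w \<in> words {..<n} \<Longrightarrow> final_state x w \<in> states n"
  by (induction x w rule: final_state.induct) (auto intro: next_state_states)

lemma next_state_twice:
  assumes "x \<in> states n" "i < n"
  shows "next_state (next_state x i) i = x \<and> emit (next_state x i) i = emit x i"
proof (cases i)
  case 0
  then show ?thesis using assms by (cases x) (auto simp: states_def)
next
  case (Suc j)
  then obtain A p q B where "length A = j" "x = A @ p # q # B"
    using assms split_two[of j x] by (auto simp: states_def)
  then show ?thesis using Suc by auto
qed

lemma emit_cases: "emit x i = [] \<or> (\<exists>j. emit x i = [j])"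
  by (cases i) (auto simp: emit.simps)

lemma emit_less:
  assumes "x \<in> states n" "i < n" "j \<in> set (emit x i)"
  shows "j < n"
proof (cases i)
  case 0
  then show ?thesis using assms by (cases x) (auto simp: states_def split: if_splits)
next
  case (Suc m)
  then obtain A p q B where "length A = m" "x = A @ p # q # B"
    using assms split_two[of m x] by (auto simp: states_def)
  then show ?thesis using assms Suc count_le[of A] count_le[of B]
    by (auto simp: states_def split: if_splits)
qed

lemma run_words: "x \<in> states n \<Longrightarrow> w \<in> words {..<n} \<Longrightarrow> run x w \<in> words {..<n}"
proof (induction x w rule: run.induct)
  case (2 x i b w)
  then show ?case
    using emit_less[of x n i] next_state_states[of x n i] emit_cases[of x i] by auto
qed simp

section \<open>Compatibility of the output with the defining relations\<close>

abbreviation shephard_rel :: "nat \<Rightarrow> (nat word \<times> nat word) set" where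
  "shephard_rel n \<equiv> pres_rel {..<n} (shephard_rels n)"

lemma shephard_rel_commute:
  assumes "i < n" "j < n" "i + 2 \<le> j \<or> j + 2 \<le> i"
  shows "([gen i, gen j], [gen j, gen i]) \<in> shephard_rel n"
  by (rule pres_rel.rel) (use assms in \<open>auto simp: shephard_rels_def\<close>)

lemma shephard_rel_braid:
  assumes "0 < j" "Suc j < n"
  shows "([gen j, gen (Suc j), gen j], [gen (Suc j), gen j, gen (Suc j)]) \<in> shephard_rel n"
  by (rule pres_rel.rel) (use assms in \<open>auto simp: shephard_rels_def\<close>)

lemma shephard_rel_four:
  assumes "1 < n"
  shows "([gen 0, gen 1, gen 0, gen 1], [gen 1, gen 0, gen 1, gen 0]) \<in> shephard_rel n"
  by (rule pres_rel.rel) (use assms in \<open>auto simp: shephard_rels_def\<close>)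

lemma shephard_rel_square:
  assumes "0 < n"
  shows "([gen 0, gen 0], []) \<in> shephard_rel n"
  by (rule pres_rel.rel) (use assms in \<open>auto simp: shephard_rels_def\<close>)

text \<open>If exactly two of the three entries agree, both sides output the same single letter; if
  all differ, neither outputs anything. Three equal entries give a braid relation, with its sides
  exchanged for \<open>-1\<close>, whose numbering runs from right to left.\<close>

lemma run_braid:
  assumes "x \<in> states n" "0 < j" "Suc j < n"
  shows "final_state x [gen j, gen (Suc j), gen j] = final_state x [gen (Suc j), gen j, gen (Suc j)] \<and>
    (run x [gen j, gen (Suc j), gen j], run x [gen (Suc j), gen j, gen (Suc j)]) \<in> shephard_rel n"
proof -
  obtain i where i: "j = Suc i" using assms by (cases j) auto
  obtain A p q r B where A: "length A = i" and x: "x = A @ p # q # r # B"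
    using assms i split_three[of i x] by (auto simp: states_def)
  have n: "n = length A + length B + 3" and pqr: "p \<in> {-1,0,1}" "q \<in> {-1,0,1}" "r \<in> {-1,0,1}"
    using assms x by (auto simp: states_def)
  note b = shephard_rel_braid
  show ?thesis
    using pqr n count_le(3)[of A] count_le(2)[of B]
    unfolding i x A[symmetric]
    by (elim insertE emptyE)
      (simp_all add: swap_after_one pres_rel.refl b b[THEN pres_rel.sym])
qed

text \<open>A relation of the group enters only for two zeros. Otherwise both sides output the same
  single letter: \<open>0\<close> if exactly one entry is zero, the swap of two equal signs if none
  is.\<close>

lemma run_four:
  assumes "x \<in> states n" "1 < n"
  shows "final_state x [gen 0, gen 1, gen 0, gen 1] = final_state x [gen 1, gen 0, gen 1, gen 0] \<and>
    (run x [gen 0, gen 1, gen 0, gen 1], run x [gen 1, gen 0, gen 1, gen 0]) \<in> shephard_rel n"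
proof -
  obtain p q B where x: "x = p # q # B"
    using assms split_two[of 0 x] by (auto simp: states_def)
  have n: "n = length B + 2" and pq: "p \<in> {-1,0,1}" "q \<in> {-1,0,1}"
    using assms x by (auto simp: states_def)
  note s = next_swap[of "[]", simplified] emit_swap[of "[]", simplified]
  show ?thesis
    using pq n count_le[of B] unfolding x
    by (elim insertE emptyE) (simp_all add: s pres_rel.refl shephard_rel_four[simplified])
qed

lemma run_square:
  assumes "x \<in> states n" "0 < n"
  shows "final_state x [gen 0, gen 0] = x \<and> (run x [gen 0, gen 0], []) \<in> shephard_rel n"
proof -
  obtain p B where x: "x = p # B"
    using assms by (cases x) (auto simp: states_def)
  show ?thesis
    using assms unfolding x by (auto intro!: pres_rel.refl shephard_rel_square)
qed

lemma run_commute: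
  assumes "x \<in> states n" "i + 2 \<le> j" "j < n"
  shows "final_state x [gen i, gen j] = final_state x [gen j, gen i] \<and>
    (run x [gen i, gen j], run x [gen j, gen i]) \<in> shephard_rel n"
proof -
  obtain m where m: "j = Suc m" using assms by (cases j) auto
  obtain C r s D where C: "length C = m" and xC: "x = C @ r # s # D"
    using assms m split_two[of m x] by (auto simp: states_def)
  \<comment> \<open>The letters move disjoint entries, and the counts in \<open>block_gen\<close>
    ignore rearrangements within \<open>A\<close> or \<open>B\<close> and sign changes in
    \<open>A\<close>. The numbers attached to the two places are disjoint, so two outputs differ by
    at least 2; either letter may give the larger one.\<close>
  have *: "next_state (next_state x i) j = next_state (next_state x j) i \<and>
    emit (next_state x i) j = emit x j \<and> emit (next_state x j) i = emit x i \<and>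
    (\<forall>a\<in>set (emit x i). \<forall>b\<in>set (emit x j). a + 2 \<le> b \<or> b + 2 \<le> a)"
  proof (cases i)
    case 0
    then obtain p B where B: "C = p # B" using C m assms by (cases C) auto
    have v: "p \<in> {-1,0,1}" "r \<in> {-1,0,1}"
      using assms xC B by (auto simp: states_def)
    show ?thesis
      using v unfolding 0 m C[symmetric] xC B
      by (elim insertE emptyE) (simp_all add: swap_after_tail)
  next
    case (Suc l)
    obtain A p q B where A: "length A = l" and x: "C = A @ p # q # B"
      using assms m C Suc split_two[of l C] by auto
    have v: "p \<in> {-1,0,1}" "q \<in> {-1,0,1}" "r \<in> {-1,0,1}"
      using assms xC x by (auto simp: states_def)
    show ?thesis
      using v count_le[of B] count_le[of A]
      unfolding Suc m C[symmetric] xC x A[symmetric]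
      by (elim insertE emptyE) (simp_all add: swap_after_two)
  qed
  consider "emit x i = []" | "emit x j = []" | a b where "emit x i = [a]" "emit x j = [b]"
    using emit_cases by metis
  then show ?thesis
  proof cases
    case 3
    then have "([gen a, gen b], [gen b, gen a]) \<in> shephard_rel n"
      using * assms emit_less[of x n i a] emit_less[of x n j b]
      by (intro shephard_rel_commute) auto
    then show ?thesis using * 3 by simp
  next
    case 1
    have "run x [gen j] \<in> words {..<n}" using assms run_words[of x n "[gen j]"] by simp
    then show ?thesis using * 1 by (simp add: pres_rel.refl)
  next
    case 2
    have "run x [gen i] \<in> words {..<n}" using assms run_words[of x n "[gen i]"] by simp
    then show ?thesis using * 2 by (simp add: pres_rel.refl)
  qed
qed

lemma run_relations:
  assumes "(u, v) \<in> shephard_rels n" "u \<in> words {..<n}" "v \<in> words {..<n}" "x \<in> states n"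
  shows "final_state x u = final_state x v \<and> (run x u, run x v) \<in> shephard_rel n"
proof -
  from assms(1)[unfolded shephard_rels_def] show ?thesis
  proof (elim UnE, goal_cases)
    case 1
    then show ?case using assms run_square[of x n] by simp
  next
    case 2
    then show ?case using assms run_four[of x n] by simp
  next
    case 3
    then show ?case using assms run_braid[of x n] by fastforce
  next
    case 4
    then obtain i j where ij: "i < n" "j < n" "\<bar>int i - int j\<bar> \<ge> 2"
      "u = [gen i, gen j]" "v = [gen j, gen i]" by blast
    then have "i + 2 \<le> j \<or> j + 2 \<le> i" by linarith
    then show ?case
      using ij assms(4) run_commute[of x n i j] run_commute[of x n j i] pres_rel.sym by metis
  qed
qed

text \<open>Hence \<open>run x\<close> descends to a map on the group. Concatenation needs the
  equality of final states: the second factors must be read from the same vector.\<close>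

lemma run_respects:
  assumes "(u, v) \<in> shephard_rel n" "x \<in> states n"
  shows "final_state x u = final_state x v \<and> (run x u, run x v) \<in> shephard_rel n"
  using assms
proof (induction arbitrary: x rule: pres_rel.induct)
  case (rel u v)
  then show ?case using run_relations by blast
next
  case (cancel i b)
  then have i: "i < n" by simp
  note t = next_state_twice[OF cancel.prems i]
  show ?case
    using t emit_cases[of x i] emit_less[OF cancel.prems i]
    by (auto simp: pres_rel.refl pres_rel.cancel)
next
  case (cong u u' v v')
  have "final_state x u \<in> states n"
    using cong pres_rel_words final_state_states by metis
  then show ?case
    using cong by (auto simp: final_state_append run_append intro!: pres_rel.cong)
next
  case (refl u)
  then show ?case by (auto intro: pres_rel.refl run_words)
next
  case (sym u v)
  then show ?case by (metis pres_rel.sym)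
next
  case (trans u v w)
  then show ?case by (metis pres_rel.trans)
qed

section \<open>The action on the initial vector\<close>

definition start :: "nat \<Rightarrow> nat \<Rightarrow> int list" where
  "start n k = replicate k 0 @ replicate (n - k) 1"

lemma start_states: "k < n \<Longrightarrow> start n k \<in> states n"
  by (auto simp: start_def states_def)

lemma count_replicate [simp]:
  "count_zero (replicate m 0) = m" "count_zero (replicate m 1) = 0"
  "count_nonpos (replicate m 0) = m" "count_nonpos (replicate m 1) = 0"
  by (simp_all add: count_zero_def count_nonpos_def)

lemma replicate_split:
  assumes "Suc m < l"
  shows "replicate l c = replicate m c @ c # c # replicate (l - m - 2) c"
proof -
  have "replicate l c = replicate (m + Suc (Suc (l - m - 2))) c"
    using assms by (intro arg_cong[of _ _ "\<lambda>i. replicate i c"]) auto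
  then show ?thesis by (simp add: replicate_add replicate_app_Cons_same)
qed

text \<open>The numbering attached to \<open>start n k\<close> is the identity, so a letter that
  fixes this vector is output unchanged.\<close>

lemma start_step:
  assumes "k < n" "i < n" "i \<noteq> k"
  shows "next_state (start n k) i = start n k \<and> emit (start n k) i = [i]"
proof (cases i)
  case 0
  then have "start n k = 0 # replicate (k - 1) 0 @ replicate (n - k) 1"
    using assms by (cases k) (auto simp: start_def)
  then show ?thesis using 0 by simp
next
  case (Suc m)
  show ?thesis
  proof (cases "i < k")
    case True
    then have "start n k = replicate m 0 @ 0 # 0 # replicate (k - m - 2) 0 @ replicate (n - k) 1"
      using Suc replicate_split[of m k "0 :: int"] by (simp add: start_def)
    then show ?thesis
      using Suc next_swap[of "replicate m 0" 0 0] emit_swap[of "replicate m 0" 0 0] by simp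
  next
    case False
    then have m: "k \<le> m" "Suc (m - k) < n - k" using assms Suc by auto
    let ?A = "replicate k 0 @ replicate (m - k) 1"
    have "start n k = ?A @ 1 # 1 # replicate (n - m - 2) 1"
      using m replicate_split[of "m - k" "n - k" "1 :: int"] by (simp add: start_def)
    then show ?thesis
      using m Suc next_swap[of ?A 1 1] emit_swap[of ?A 1 1] by simp
  qed
qed

text \<open>Source of the left equivariance: a prefix without \<open>k\<close> is copied and leads
  back to the start.\<close>

lemma run_start:
  assumes "k < n" "w \<in> words ({..<n} - {k})"
  shows "final_state (start n k) w = start n k \<and> run (start n k) w = w"
  using assms(2) by (induction w) (auto simp: start_step[OF assms(1)])

text \<open>
  An invariant of the vectors reached from \<open>start n k\<close> without using the letter \<open>l\<close>, or using
  all letters if \<open>l = k\<close>; it prevents the output \<open>l\<close>.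
\<close>

definition avoiding_states :: "nat \<Rightarrow> nat \<Rightarrow> nat \<Rightarrow> int list set" where
  "avoiding_states n k l =
     (if l < k then {replicate l 0 @ y | y. length y = n - l \<and> set y \<subseteq> {0, 1}}
      else if l = k then {x \<in> states n. count_zero x = k}
      else {y @ replicate (n - l) 1 | y. y \<in> states l \<and> count_zero y = k})"

lemma start_avoiding:
  assumes "k < n" "l < n"
  shows "start n k \<in> avoiding_states n k l"
proof -
  consider "l < k" | "l = k" | "k < l" by linarith
  then show ?thesis
  proof cases
    case 1
    have "start n k = replicate l 0 @ replicate (k - l) 0 @ replicate (n - k) 1"
      using 1 by (simp add: start_def flip: replicate_add append_assoc)
    moreover have "length (replicate (k - l) (0 :: int) @ replicate (n - k) 1) = n - l"
      "set (replicate (k - l) (0 :: int) @ replicate (n - k) 1) \<subseteq> {0, 1}"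
      using 1 assms by auto
    ultimately show ?thesis using 1 unfolding avoiding_states_def by auto
  next
    case 2
    then show ?thesis using assms start_states[of k n]
      by (auto simp: avoiding_states_def start_def)
  next
    case 3
    have "start n k = start l k @ replicate (n - l) 1"
      using 3 assms by (simp add: start_def flip: replicate_add)
    moreover have "start l k \<in> states l" "count_zero (start l k) = k"
      using 3 start_states by (auto simp: start_def)
    ultimately show ?thesis using 3 unfolding avoiding_states_def by auto
  qed
qed

text \<open>An output \<open>l > 0\<close> would exchange the numbers \<open>l\<close> and
  \<open>l + 1\<close>. For \<open>l < k\<close> the first \<open>l\<close> entries are zeros
  numbered up to \<open>l\<close>; for \<open>l > k\<close> the last \<open>n - l\<close> entries
  are ones numbered above \<open>l\<close>; only the excluded letter \<open>l\<close> crosses this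
  border. For \<open>l = k\<close> the zeros have the numbers up to \<open>k\<close> and the nonzero
  entries larger ones. An output \<open>0\<close> needs letter \<open>0\<close> on a zero: the
  letter is excluded if \<open>0 < k\<close>, and there are no zeros if
  \<open>k = 0\<close>.\<close>

lemma avoiding_step:
  assumes "k < n" "l < n" "i < n" "i \<noteq> l \<or> l = k" "x \<in> avoiding_states n k l"
  shows "next_state x i \<in> avoiding_states n k l \<and> l \<notin> set (emit x i)"
proof -
  consider (less) "l < k" | (equal) "l = k" | (greater) "k < l" by linarith
  then show ?thesis
  proof cases
    case less
    then obtain y where x: "x = replicate l 0 @ y" and y: "length y = n - l" "set y \<subseteq> {0, 1}"
      using assms by (auto simp: avoiding_states_def)
    show ?thesis
    proof (cases "i < l")
      case True
      have "next_state x i = x \<and> emit x i = [i]"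
      proof (cases i)
        case 0
        then show ?thesis using True x by (cases l) auto
      next
        case (Suc m)
        then have "x = replicate m 0 @ 0 # 0 # replicate (l - m - 2) 0 @ y"
          using x True replicate_split[of m l "0 :: int"] by simp
        then show ?thesis
          using Suc next_swap[of "replicate m 0" 0 0] emit_swap[of "replicate m 0" 0 0] by simp
      qed
      then show ?thesis using True assms by simp
    next
      case False
      then obtain m where m: "i = Suc m" "l \<le> m" using assms less by (cases i) auto
      then have "Suc (m - l) < length y" using assms y by auto
      then obtain A p q B where A: "length A = m - l" "y = A @ p # q # B"
        using split_two by blast
      let ?A = "replicate l 0 @ A"
      have "length ?A = m" "x = ?A @ p # q # B" using A m x by auto
      then have "next_state x i = ?A @ q # p # B"
        "emit x i = (if p = q then [block_gen ?A p B] else [])"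
        using m next_swap[of ?A p q B] emit_swap[of ?A p q B] by simp_all
      then show ?thesis using less A y by (auto simp: avoiding_states_def)
    qed
  next
    case equal
    then have x: "x \<in> states n" "count_zero x = k" using assms by (auto simp: avoiding_states_def)
    have *: "count_zero (next_state x i) = k \<and> k \<notin> set (emit x i)"
    proof (cases i)
      case 0
      then show ?thesis using x assms by (cases x) (auto simp: states_def)
    next
      case (Suc m)
      then obtain A p q B where "length A = m" "x = A @ p # q # B"
        using assms x split_two[of m x] by (auto simp: states_def)
      then show ?thesis using Suc x count_le[of A] count_le[of B] by (auto simp: states_def)
    qed
    then show ?thesis
      using equal x next_state_states[of x n i] assms by (simp add: avoiding_states_def)
  next
    case greater
    then obtain y where x: "x = y @ replicate (n - l) 1" and y: "y \<in> states l" "count_zero y = k"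
      using assms by (auto simp: avoiding_states_def)
    show ?thesis
    proof (cases "i < l")
      case True
      have "next_state x i = next_state y i @ replicate (n - l) 1 \<and>
        count_zero (next_state y i) = k \<and> l \<notin> set (emit x i)"
      proof (cases i)
        case 0
        then show ?thesis using True x y by (cases y) (auto simp: states_def)
      next
        case (Suc m)
        then obtain A p q B where "length A = m" "y = A @ p # q # B"
          using y True split_two[of m y] by (auto simp: states_def)
        then show ?thesis
          using Suc x y count_le[of A] count_le[of B] by (auto simp: states_def)
      qed
      then show ?thesis using greater next_state_states[OF y(1) True]
        by (auto simp: avoiding_states_def)
    next
      case False
      then obtain m where m: "i = Suc m" "l \<le> m" using assms greater by (cases i) auto
      let ?A = "y @ replicate (m - l) 1"
      have "length ?A = m" "x = ?A @ 1 # 1 # replicate (n - m - 2) 1"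
        using x m assms y replicate_split[of "m - l" "n - l" "1 :: int"] by (auto simp: states_def)
      then have "next_state x i = x \<and> emit x i = [i]"
        using m next_swap[of ?A 1 1] emit_swap[of ?A 1 1] by simp
      then show ?thesis using assms greater by simp
    qed
  qed
qed

lemma run_avoiding:
  assumes "k < n" "l < n" "w \<in> words {..<n}" "l = k \<or> w \<in> words ({..<n} - {l})"
    "x \<in> avoiding_states n k l"
  shows "l \<notin> fst ` set (run x w)"
  using assms(3-)
proof (induction x w rule: run.induct)
  case (2 x i b w)
  then have "next_state x i \<in> avoiding_states n k l \<and> l \<notin> set (emit x i)"
    using avoiding_step[of k n l i x] assms(1,2) by auto
  then show ?case using 2 by auto
qed simp

lemma words_iff: "w \<in> words X \<longleftrightarrow> fst ` set w \<subseteq> X"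
  by (induction w) auto

text \<open>Each letter outside \<open>L - {k}\<close> is ruled out by its own invariant:
  \<open>k\<close> always, any other because \<open>w\<close> does not use it.\<close>

lemma run_start_words:
  assumes "k < n" "L \<subseteq> {..<n}" "w \<in> words L"
  shows "run (start n k) w \<in> words (L - {k})"
proof -
  have w: "w \<in> words {..<n}" using assms by (auto simp: words_iff)
  have "run (start n k) w \<in> words {..<n}"
    using run_words w start_states assms(1) by blast
  moreover have "l \<notin> fst ` set (run (start n k) w)" if "l < n" "l \<notin> L \<or> l = k" for l
  proof (rule run_avoiding[of k n])
    show "l = k \<or> w \<in> words ({..<n} - {l})" using that assms by (auto simp: words_iff)
  qed (use that assms w start_avoiding in auto)
  ultimately show ?thesis by (fastforce simp: words_iff)
qed

lemma generate_pres_gen: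
  assumes "L \<subseteq> X"
  shows "generate (presented_group X R) (pres_gen X R ` L) = (\<lambda>w. pres_rel X R `` {w}) ` words L"
    (is "?A = ?B")
proof
  have LX: "w \<in> words X" if "w \<in> words L" for w using that assms by (auto simp: words_iff)
  show "?A \<subseteq> ?B"
  proof
    fix g assume "g \<in> ?A"
    then show "g \<in> ?B"
    proof (induction rule: generate.induct)
      case one
      then show ?case by (auto simp: pres_one)
    next
      case (incl h)
      then obtain x where "x \<in> L" "h = pres_rel X R `` {[(x, True)]}" by (auto simp: pres_gen_def)
      then show ?case by (intro image_eqI[of _ _ "[(x, True)]"]) auto
    next
      case (inv h)
      interpret group "presented_group X R" by (rule group_presented_group)
      from inv obtain x where x: "x \<in> L" "h = pres_gen X R x" by auto
      have "h \<in> carrier (presented_group X R)"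
        using x assms by (auto simp: pres_gen_def intro!: pres_class_carrier)
      then have "inv\<^bsub>presented_group X R\<^esub> h = pres_rel X R `` {[(x, False)]}"
        using word_eval_pres_gen[of "[(x, False)]" X R] x assms by auto
      then show ?case using x by (intro image_eqI[of _ _ "[(x, False)]"]) auto
    next
      case (eng g h)
      then obtain u v where "u \<in> words L" "v \<in> words L"
        "g = pres_rel X R `` {u}" "h = pres_rel X R `` {v}" by blast
      then show ?case using LX by (intro image_eqI[of _ _ "u @ v"]) (auto simp: pres_mult)
    qed
  qed
  have "word_eval (presented_group X R) (pres_gen X R) w \<in> ?A" if "w \<in> words L" for w
    using that
  proof (induction w)
    case (Cons c w)
    then show ?case by (cases c) (auto intro: generate.eng generate.incl generate.inv)
  qed (simp add: generate.one)
  then show "?B \<subseteq> ?A" using LX by (auto simp flip: word_eval_pres_gen)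
qed

section \<open>Retractions onto parabolic subgroups\<close>

text \<open>A map of sets, not a homomorphism. The case \<open>L = {}\<close> gives
  \<open>r \<one> = \<one>\<close>, so by equivariance \<open>r\<close> fixes the subgroup of
  \<open>J\<close> pointwise.\<close>

definition parabolic_retraction ::
    "('g, 'm) monoid_scheme \<Rightarrow> ('i \<Rightarrow> 'g) \<Rightarrow> 'i set \<Rightarrow> 'i set \<Rightarrow> ('g \<Rightarrow> 'g) \<Rightarrow> bool" where
  "parabolic_retraction G a I J r \<longleftrightarrow>
     (\<forall>x \<in> generate G (a ` J). \<forall>g \<in> carrier G. r (x \<otimes>\<^bsub>G\<^esub> g) = x \<otimes>\<^bsub>G\<^esub> r g) \<and>
     (\<forall>L \<subseteq> I. r ` generate G (a ` L) \<subseteq> generate G (a ` (L \<inter> J)))"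

lemma shephard_retraction:
  assumes "k < n"
  shows "\<exists>r. parabolic_retraction (shephard_B2inf n) (shephard_gen n) {..<n} ({..<n} - {k}) r"
proof -
  define c where "c w = shephard_rel n `` {w}" for w
  \<comment> \<open>By \<open>run_respects\<close> the class of the output does not depend on the
    chosen representative.\<close>
  define r where "r A = c (run (start n k) (SOME w. w \<in> A))" for A
  have r: "r (c w) = c (run (start n k) w)" if "w \<in> words {..<n}" for w
  proof -
    have "w \<in> c w" using that by (auto simp: c_def intro: pres_rel.refl)
    then have "(SOME v. v \<in> c w) \<in> c w" by (rule someI)
    then have "(w, SOME v. v \<in> c w) \<in> shephard_rel n" by (simp add: c_def)
    then have "(run (start n k) w, run (start n k) (SOME v. v \<in> c w)) \<in> shephard_rel n"
      using run_respects start_states assms by blast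
    from equiv_class_eq[OF equiv_pres_rel this] show ?thesis by (simp add: c_def r_def)
  qed
  have gen: "generate (shephard_B2inf n) (shephard_gen n ` L) = c ` words L" if "L \<subseteq> {..<n}" for L
    using generate_pres_gen[OF that] by (simp add: shephard_B2inf_def shephard_gen_def c_def)
  have mult: "c u \<otimes>\<^bsub>shephard_B2inf n\<^esub> c v = c (u @ v)"
    if "u \<in> words {..<n}" "v \<in> words {..<n}" for u v
    using pres_mult[OF that] by (simp add: shephard_B2inf_def c_def)
  have car: "carrier (shephard_B2inf n) = c ` words {..<n}"
    unfolding shephard_B2inf_def c_def
    by (auto elim!: pres_class_cases intro: pres_class_carrier)
  have "r (c u \<otimes>\<^bsub>shephard_B2inf n\<^esub> c v) = c u \<otimes>\<^bsub>shephard_B2inf n\<^esub> r (c v)"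
    if u: "u \<in> words ({..<n} - {k})" and v: "v \<in> words {..<n}" for u v
  proof -
    have u': "u \<in> words {..<n}" using u by (auto simp: words_iff)
    have "run (start n k) v \<in> words {..<n}" using v run_words start_states assms by blast
    then show ?thesis
      using u u' v run_start[OF assms u] by (simp add: mult r run_append)
  qed
  moreover have "r (c w) \<in> c ` words (L - {k})" if "L \<subseteq> {..<n}" "w \<in> words L" for w L
  proof -
    have "w \<in> words {..<n}" using that by (auto simp: words_iff)
    then show ?thesis using r run_start_words[OF assms that] by auto
  qed
  moreover have "generate (shephard_B2inf n) (shephard_gen n ` (L \<inter> ({..<n} - {k}))) = c ` words (L - {k})"
    if "L \<subseteq> {..<n}" for L
  proof -
    have "L \<inter> ({..<n} - {k}) = L - {k}" using that by auto
    then show ?thesis using that gen[of "L - {k}"] by auto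
  qed
  ultimately have "parabolic_retraction (shephard_B2inf n) (shephard_gen n) {..<n} ({..<n} - {k}) r"
    unfolding parabolic_retraction_def car by (auto simp: gen)
  then show ?thesis by blast
qed


text \<open>Collects what the intersection and coset arguments use about the Shephard groups.
  Subgroups are given by sets of indices, so \<open>a\<close> may repeat values.\<close>

locale parabolic_retractions = group G for G (structure) +
  fixes a :: "'i \<Rightarrow> 'a" and I :: "'i set"
  assumes finite_index: "finite I"
    and generators: "generate G (a ` I) = carrier G" "a ` I \<subseteq> carrier G"
    and maximal: "k \<in> I \<Longrightarrow> \<exists>r. parabolic_retraction G a I (I - {k}) r"
begin

abbreviation parabolic :: "'i set \<Rightarrow> 'a set" where
  "parabolic J \<equiv> generate G (a ` J)"

lemma parabolic_subgroup: "J \<subseteq> I \<Longrightarrow> subgroup (parabolic J) G"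
  by (rule generate_is_subgroup) (use generators in auto)

lemma parabolic_mono: "J \<subseteq> K \<Longrightarrow> parabolic J \<subseteq> parabolic K"
  by (rule mono_generate) auto

lemma retraction_comp:
  assumes "parabolic_retraction G a I J r" "parabolic_retraction G a I K s" "J \<subseteq> I" "K \<subseteq> I"
  shows "parabolic_retraction G a I (J \<inter> K) (r \<circ> s)"
  unfolding parabolic_retraction_def
proof (intro conjI ballI allI impI)
  fix x g assume x: "x \<in> parabolic (J \<inter> K)" and g: "g \<in> carrier G"
  have "x \<in> parabolic J" "x \<in> parabolic K"
    using x parabolic_mono[of "J \<inter> K" J] parabolic_mono[of "J \<inter> K" K] by auto
  moreover have "s g \<in> carrier G"
  proof -
    have "s ` parabolic I \<subseteq> parabolic (I \<inter> K)"
      using assms(2) unfolding parabolic_retraction_def by blast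
    then show ?thesis using g generators parabolic_mono[of "I \<inter> K" I] by auto
  qed
  ultimately show "(r \<circ> s) (x \<otimes> g) = x \<otimes> (r \<circ> s) g"
    using assms g by (simp add: parabolic_retraction_def)
next
  fix L assume L: "L \<subseteq> I"
  have "s ` parabolic L \<subseteq> parabolic (L \<inter> K)" "r ` parabolic (L \<inter> K) \<subseteq> parabolic (L \<inter> K \<inter> J)"
    using assms L unfolding parabolic_retraction_def by (blast, meson inf.coboundedI1)
  moreover have "L \<inter> K \<inter> J = L \<inter> (J \<inter> K)" by auto
  ultimately show "(r \<circ> s) ` parabolic L \<subseteq> parabolic (L \<inter> (J \<inter> K))" by auto
qed

lemma retraction_exists:
  assumes "J \<subseteq> I"
  shows "\<exists>r. parabolic_retraction G a I J r"
proof -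
  \<comment> \<open>Indices outside \<open>J\<close> are removed one at a time, each by composing
    with the retraction that omits it.\<close>
  have "\<exists>r. parabolic_retraction G a I (I - D) r" if "finite D" "D \<subseteq> I" for D
    using that
  proof induction
    case empty
    have "parabolic_retraction G a I I id"
      by (auto simp: parabolic_retraction_def Int_absorb2)
    then show ?case by auto
  next
    case (insert k D)
    then obtain r s where "parabolic_retraction G a I (I - {k}) r"
      "parabolic_retraction G a I (I - D) s"
      using maximal by blast
    then have "parabolic_retraction G a I ((I - {k}) \<inter> (I - D)) (r \<circ> s)"
      by (rule retraction_comp) auto
    moreover have "(I - {k}) \<inter> (I - D) = I - insert k D" by auto
    ultimately show ?case by auto
  qed
  from this[of "I - J"] show ?thesis
    using assms finite_index by (simp add: double_diff)
qed

text \<open>An element of both subgroups is fixed by the retraction for \<open>J\<close>, and its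
  image lies in \<open>parabolic (K \<inter> J)\<close>.\<close>

lemma parabolic_Int:
  assumes J: "J \<subseteq> I" and K: "K \<subseteq> I"
  shows "parabolic J \<inter> parabolic K = parabolic (J \<inter> K)"
proof
  show "parabolic (J \<inter> K) \<subseteq> parabolic J \<inter> parabolic K"
    using parabolic_mono[of "J \<inter> K" J] parabolic_mono[of "J \<inter> K" K] by auto
  obtain r where r: "parabolic_retraction G a I J r" using retraction_exists J by blast
  have "r ` parabolic {} \<subseteq> parabolic ({} \<inter> J)"
    using r unfolding parabolic_retraction_def by (meson empty_subsetI)
  then have "r \<one> = \<one>" by (simp add: generate_empty)
  show "parabolic J \<inter> parabolic K \<subseteq> parabolic (J \<inter> K)"
  proof
    fix g assume g: "g \<in> parabolic J \<inter> parabolic K"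
    have "g \<in> carrier G" using g parabolic_subgroup[OF J] subgroup.mem_carrier by fastforce
    moreover have "r (g \<otimes> \<one>) = g \<otimes> r \<one>" using r g by (simp add: parabolic_retraction_def)
    ultimately have "r g = g" using \<open>r \<one> = \<one>\<close> by simp
    moreover have "r ` parabolic K \<subseteq> parabolic (K \<inter> J)"
      using r K by (simp add: parabolic_retraction_def)
    ultimately show "g \<in> parabolic (J \<inter> K)" using g by (auto simp: Int_commute)
  qed
qed

lemma parabolic_factor:
  assumes J: "J \<subseteq> I" and K: "K \<subseteq> I" and L: "L \<subseteq> I"
    and y: "y \<in> parabolic J" and k: "y \<otimes> l \<in> parabolic K" and l: "l \<in> parabolic L"
  shows "\<exists>p \<in> parabolic J. \<exists>m \<in> parabolic K \<inter> parabolic L. y \<otimes> l = p \<otimes> m"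
proof -
  note sub = parabolic_subgroup[OF J] parabolic_subgroup[OF K] parabolic_subgroup[OF L]
  have car: "y \<in> carrier G" "l \<in> carrier G"
    using y l sub subgroup.mem_carrier by metis+
  obtain r where r: "parabolic_retraction G a I J r" using retraction_exists J by blast
  define p where "p = r (y \<otimes> l)"
  define q where "q = r l"
  \<comment> \<open>Lying in \<open>parabolic J\<close> makes \<open>p\<close> a legal first factor;
    lying in \<open>parabolic K\<close> and \<open>parabolic L\<close> keeps the quotients by
    \<open>p\<close> and \<open>q\<close> there.\<close>
  have "p \<in> parabolic (K \<inter> J)" "q \<in> parabolic (L \<inter> J)"
    using r K L k l unfolding p_def q_def parabolic_retraction_def by blast+
  then have pq: "p \<in> parabolic J" "p \<in> parabolic K" "q \<in> parabolic L"
    using parabolic_mono[of "K \<inter> J" J] parabolic_mono[of "K \<inter> J" K] parabolic_mono[of "L \<inter> J" L]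
      \<open>p \<in> parabolic (K \<inter> J)\<close> by auto
  have pqc: "p \<in> carrier G" "q \<in> carrier G"
    using pq sub subgroup.mem_carrier by metis+
  have "p = y \<otimes> q"
    using r y car unfolding p_def q_def parabolic_retraction_def by blast
  moreover have "q \<otimes> (inv q \<otimes> l) = l"
    using car pqc by (simp add: m_assoc[symmetric])
  ultimately have factor: "y \<otimes> l = p \<otimes> (inv q \<otimes> l)"
    using car pqc by (simp add: m_assoc)
  then have "inv p \<otimes> (y \<otimes> l) = inv q \<otimes> l"
    using car pqc by (simp add: m_assoc[symmetric])
  moreover have "inv p \<otimes> (y \<otimes> l) \<in> parabolic K"
    using sub(2) pq k by (simp add: subgroup.m_closed subgroup.m_inv_closed)
  moreover have "inv q \<otimes> l \<in> parabolic L"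
    using sub(3) pq l by (simp add: subgroup.m_closed subgroup.m_inv_closed)
  ultimately have "inv q \<otimes> l \<in> parabolic K \<inter> parabolic L" by simp
  then show ?thesis using pq factor by blast
qed

lemma parabolic_product_Int:
  assumes J: "J \<subseteq> I" and K: "K \<subseteq> I" and L: "L \<subseteq> I"
  shows "(parabolic J <#> parabolic K) \<inter> (parabolic J <#> parabolic L)
    = parabolic J <#> (parabolic K \<inter> parabolic L)"
proof
  show "parabolic J <#> (parabolic K \<inter> parabolic L)
    \<subseteq> (parabolic J <#> parabolic K) \<inter> (parabolic J <#> parabolic L)"
    by (auto simp: set_mult_def)
  show "(parabolic J <#> parabolic K) \<inter> (parabolic J <#> parabolic L)
    \<subseteq> parabolic J <#> (parabolic K \<inter> parabolic L)"
  proof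
    fix g assume "g \<in> (parabolic J <#> parabolic K) \<inter> (parabolic J <#> parabolic L)"
    then obtain x k x' l where
      e: "x \<in> parabolic J" "k \<in> parabolic K" "x' \<in> parabolic J" "l \<in> parabolic L"
      and g: "g = x \<otimes> k" "g = x' \<otimes> l"
      by (auto simp: set_mult_def)
    note sub = parabolic_subgroup[OF J] parabolic_subgroup[OF K] parabolic_subgroup[OF L]
    have car: "x \<in> carrier G" "k \<in> carrier G" "x' \<in> carrier G" "l \<in> carrier G"
      using e sub subgroup.mem_carrier by metis+
    have k: "k = (inv x \<otimes> x') \<otimes> l"
      using g car by (metis inv_closed inv_solve_left' m_assoc m_closed)
    have "inv x \<otimes> x' \<in> parabolic J"
      using e sub(1) by (simp add: subgroup.m_closed subgroup.m_inv_closed)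
    then obtain p m where pm: "p \<in> parabolic J" "m \<in> parabolic K \<inter> parabolic L" "k = p \<otimes> m"
      using parabolic_factor[OF J K L _ _ e(4)] e(2) k by metis
    have "p \<in> carrier G" "m \<in> carrier G"
      using pm sub subgroup.mem_carrier by (metis IntD1)+
    then have "g = (x \<otimes> p) \<otimes> m" using g pm car by (simp add: m_assoc)
    moreover have "x \<otimes> p \<in> parabolic J" using e pm sub(1) by (simp add: subgroup.m_closed)
    ultimately show "g \<in> parabolic J <#> (parabolic K \<inter> parabolic L)"
      using pm by (auto simp: set_mult_def)
  qed
qed

section \<open>Cosets of parabolic subgroups and the Helly property\<close>

definition parabolic_coset :: "'a set \<Rightarrow> bool" where
  "parabolic_coset C \<longleftrightarrow> (\<exists>g \<in> carrier G. \<exists>J \<subseteq> I. C = g <# parabolic J)"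

lemma coset_rebase:
  assumes "g \<in> carrier G" "J \<subseteq> I" "p \<in> g <# parabolic J"
  shows "p \<in> carrier G" "g <# parabolic J = p <# parabolic J"
proof -
  have sub: "subgroup (parabolic J) G" using assms parabolic_subgroup by blast
  show "p \<in> carrier G"
    using assms subgroup.subset[OF sub] l_coset_subset_G by blast
  show "g <# parabolic J = p <# parabolic J"
    using l_repr_independence assms sub by blast
qed

lemma coset_mem_iff:
  assumes "p \<in> carrier G" "x \<in> carrier G" "J \<subseteq> I"
  shows "p \<otimes> x \<in> p <# parabolic J \<longleftrightarrow> x \<in> parabolic J"
proof -
  have "h \<in> carrier G" if "h \<in> parabolic J" for h
    using that assms(3) parabolic_subgroup subgroup.mem_carrier by metis
  then show ?thesis using assms by (auto simp: l_coset_def)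
qed

text \<open>Based at a common point, the claim reduces to \<open>parabolic_Int\<close>. This closure
  lets the Helly induction run.\<close>

lemma parabolic_coset_Int:
  assumes "parabolic_coset C" "parabolic_coset D" "C \<inter> D \<noteq> {}"
  shows "parabolic_coset (C \<inter> D)"
proof -
  obtain p where p: "p \<in> C" "p \<in> D" using assms(3) by blast
  obtain J K where JK: "J \<subseteq> I" "K \<subseteq> I" "p \<in> carrier G" "C = p <# parabolic J" "D = p <# parabolic K"
    using assms(1,2) p coset_rebase unfolding parabolic_coset_def by metis
  have "C \<inter> D = p <# parabolic (J \<inter> K)"
  proof -
    have "h \<in> carrier G" if "h \<in> parabolic J \<or> h \<in> parabolic K" for h
      using that JK parabolic_subgroup subgroup.mem_carrier by metis
    then have "C \<inter> D = p <# (parabolic J \<inter> parabolic K)"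
      using JK by (auto simp: l_coset_def)
    then show ?thesis using parabolic_Int JK by simp
  qed
  then show ?thesis using JK unfolding parabolic_coset_def by blast
qed

text \<open>With \<open>p\<close> in \<open>C \<inter> D\<close> and
  \<open>q = p \<otimes> y\<close> in \<open>C \<inter> E\<close>, a point of
  \<open>D \<inter> E\<close> gives \<open>k = y \<otimes> l\<close>. Splitting
  \<open>k = z \<otimes> m\<close> by \<open>parabolic_factor\<close> yields the common point
  \<open>p \<otimes> z = q \<otimes> (l \<otimes> inv m)\<close>.\<close>

lemma parabolic_coset_triple:
  assumes C: "parabolic_coset C" and D: "parabolic_coset D" and E: "parabolic_coset E"
    and ne: "C \<inter> D \<noteq> {}" "C \<inter> E \<noteq> {}" "D \<inter> E \<noteq> {}"
  shows "C \<inter> D \<inter> E \<noteq> {}"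
proof -
  obtain p where p: "p \<in> C" "p \<in> D" using ne by blast
  obtain J K where JK: "J \<subseteq> I" "K \<subseteq> I" "p \<in> carrier G" "C = p <# parabolic J" "D = p <# parabolic K"
    using C D p coset_rebase unfolding parabolic_coset_def by metis
  obtain q where q: "q \<in> C" "q \<in> E" using ne by blast
  obtain L where L: "L \<subseteq> I" "q \<in> carrier G" "E = q <# parabolic L"
    using E q coset_rebase unfolding parabolic_coset_def by metis
  obtain y where y: "y \<in> parabolic J" "q = p \<otimes> y"
    using q(1) JK(4) by (auto simp: l_coset_def)
  obtain k l where k: "k \<in> parabolic K" and l: "l \<in> parabolic L" and kl: "p \<otimes> k = q \<otimes> l"
    using ne(3) JK(5) L(3) by (auto simp: l_coset_def)
  have car: "y \<in> carrier G" "k \<in> carrier G" "l \<in> carrier G"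
    using y k l JK L parabolic_subgroup subgroup.mem_carrier by metis+
  have "k = y \<otimes> l"
    using kl y car JK by (simp add: m_assoc)
  then obtain z m where z: "z \<in> parabolic J" and m: "m \<in> parabolic K \<inter> parabolic L"
    and zm: "k = z \<otimes> m"
    using parabolic_factor[OF JK(1,2) L(1) y(1) _ l] k by metis
  have car': "z \<in> carrier G" "m \<in> carrier G"
    using z m JK parabolic_subgroup subgroup.mem_carrier by (metis IntD1)+
  have zK: "z = k \<otimes> inv m" using zm car car' by (simp add: m_assoc)
  have "z \<in> parabolic K"
    using zK k m parabolic_subgroup[OF JK(2)] by (simp add: subgroup.m_closed subgroup.m_inv_closed)
  then have "p \<otimes> z \<in> C" "p \<otimes> z \<in> D"
    using z JK car' coset_mem_iff by simp_all
  moreover have "p \<otimes> z = q \<otimes> (l \<otimes> inv m)"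
    unfolding zK using kl JK L car car' by (simp add: m_assoc[symmetric])
  moreover have "l \<otimes> inv m \<in> parabolic L"
    using l m parabolic_subgroup[OF L(1)] by (simp add: subgroup.m_closed subgroup.m_inv_closed)
  then have "q \<otimes> (l \<otimes> inv m) \<in> E"
    unfolding L(3) by (auto simp: l_coset_def)
  ultimately show ?thesis by auto
qed

text \<open>Intersecting all other cosets with one fixed \<open>C x\<close> shortens the family, and
  the triple property keeps it pairwise intersecting.\<close>

lemma parabolic_coset_Helly:
  assumes "finite F" "F \<noteq> {}" "\<And>x. x \<in> F \<Longrightarrow> parabolic_coset (C x)"
    "\<And>x y. x \<in> F \<Longrightarrow> y \<in> F \<Longrightarrow> C x \<inter> C y \<noteq> {}"
  shows "(\<Inter>x\<in>F. C x) \<noteq> {}"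
  using assms
proof (induction arbitrary: C rule: finite_ne_induct)
  case (singleton x)
  then show ?case by auto
next
  case (insert x F)
  define D where "D y = C x \<inter> C y" for y
  have "(\<Inter>y\<in>F. D y) \<noteq> {}"
  proof (rule insert.IH)
    show "parabolic_coset (D y)" if "y \<in> F" for y
      unfolding D_def by (rule parabolic_coset_Int) (use that insert.prems in auto)
    show "D y \<inter> D z \<noteq> {}" if "y \<in> F" "z \<in> F" for y z
      using parabolic_coset_triple[of "C x" "C y" "C z"] that insert.prems
      unfolding D_def by blast
  qed
  then show ?case using insert.hyps by (auto simp: D_def)
qed

lemma coset_complex_flag: "flag_complex (coset_complex G (\<lambda>i. parabolic (I - {i})) I)"
  unfolding flag_complex_def
proof (intro allI impI, elim conjE)
  let ?K = "coset_complex G (\<lambda>i. parabolic (I - {i})) I"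
  fix \<sigma> assume \<sigma>: "\<sigma> \<noteq> {}" "\<sigma> \<subseteq> \<Union>?K" "pairwise (\<lambda>x y. {x, y} \<in> ?K) \<sigma>"
  have vertices: "\<sigma> \<subseteq> coset_vertices G (\<lambda>i. parabolic (I - {i})) I"
    using \<sigma>(2) by (auto simp: coset_complex_def)
  have vertex: "\<exists>i g. v = (i, g <# parabolic (I - {i})) \<and> g \<in> carrier G" if "v \<in> \<sigma>" for v
    using subsetD[OF vertices that] by (auto simp: coset_vertices_def)
  have coset: "parabolic_coset (snd v)" if v: "v \<in> \<sigma>" for v
  proof -
    obtain i g where "snd v = g <# parabolic (I - {i})" "g \<in> carrier G"
      using vertex[OF v] by auto
    then show ?thesis unfolding parabolic_coset_def by blast
  qed
  have meet: "snd v \<inter> snd w \<noteq> {}" if "v \<in> \<sigma>" "w \<in> \<sigma>" for v w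
  proof (cases "v = w")
    case True
    have "v \<in> \<Union>?K" using \<sigma>(2) that by blast
    then show ?thesis using True by (auto simp: coset_complex_def)
  next
    case False
    then have "{v, w} \<in> ?K" using \<sigma>(3) that by (auto simp: pairwise_def)
    then show ?thesis by (auto simp: coset_complex_def)
  qed
  \<comment> \<open>The flag condition ranges over infinite \<open>\<sigma>\<close> too. Meeting
    cosets of the same type coincide, so \<open>\<sigma>\<close> has at most one vertex per type and
    is finite.\<close>
  have "inj_on fst \<sigma>"
  proof (rule inj_onI)
    fix v w assume vw: "v \<in> \<sigma>" "w \<in> \<sigma>" "fst v = fst w"
    obtain g i where v: "v = (i, g <# parabolic (I - {i}))" "g \<in> carrier G"
      using vertex[OF vw(1)] by auto
    obtain h j where w: "w = (j, h <# parabolic (I - {j}))" "h \<in> carrier G"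
      using vertex[OF vw(2)] by auto
    have ij: "j = i" using vw(3) v w by simp
    obtain p where "p \<in> g <# parabolic (I - {i})" "p \<in> h <# parabolic (I - {i})"
      using meet[OF vw(1,2)] v w ij by auto
    then show "v = w"
      using v w ij coset_rebase(2)[of _ "I - {i}" p] by auto
  qed
  moreover have "fst ` \<sigma> \<subseteq> I" using vertices by (auto simp: coset_vertices_def)
  ultimately have "finite \<sigma>" using finite_index by (metis finite_imageD finite_subset)
  then have "(\<Inter>v\<in>\<sigma>. snd v) \<noteq> {}"
    using parabolic_coset_Helly[of \<sigma> snd] \<sigma>(1) coset meet by blast
  then show "\<sigma> \<in> ?K"
    using \<open>finite \<sigma>\<close> \<sigma>(1) vertices by (simp add: coset_complex_def)
qed

end

section \<open>Application to the Shephard groups\<close>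

lemma shephard_parabolic_retractions:
  "parabolic_retractions (shephard_B2inf n) (shephard_gen n) {..<n}"
proof -
  interpret group "shephard_B2inf n"
    unfolding shephard_B2inf_def by (rule group_presented_group)
  show ?thesis
  proof
    show "generate (shephard_B2inf n) (shephard_gen n ` {..<n}) = carrier (shephard_B2inf n)"
      unfolding shephard_B2inf_def shephard_gen_def by (rule generate_presented_group)
    show "shephard_gen n ` {..<n} \<subseteq> carrier (shephard_B2inf n)"
      unfolding shephard_B2inf_def shephard_gen_def pres_gen_def by (auto intro!: pres_class_carrier)
  qed (use shephard_retraction in auto)
qed

theorem proposition5p13:
  fixes n :: nat
  defines "G \<equiv> shephard_B2inf n"
  defines "a \<equiv> shephard_gen n"
  defines "S \<equiv> a ` {..<n}"
  assumes "n \<ge> 2"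
  shows "(\<forall>J K. J \<subseteq> S \<longrightarrow> K \<subseteq> S \<longrightarrow>
            generate G J \<inter> generate G K = generate G (J \<inter> K)) \<and>
         (\<forall>J K L. J \<subseteq> S \<longrightarrow> K \<subseteq> S \<longrightarrow> L \<subseteq> S \<longrightarrow>
            (generate G J <#>\<^bsub>G\<^esub> generate G K) \<inter> (generate G J <#>\<^bsub>G\<^esub> generate G L)
              = generate G J <#>\<^bsub>G\<^esub> (generate G K \<inter> generate G L)) \<and>
         flag_complex (coset_complex G (\<lambda>i. generate G (a ` ({..<n} - {i}))) {..<n})"
proof -
  interpret parabolic_retractions G a "{..<n}"
    unfolding G_def a_def by (rule shephard_parabolic_retractions)
  \<comment> \<open>Translates sets of generators into sets of indices. Full preimages commute with
    intersections even if two indices name the same generator.\<close>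
  define idx where "idx J = {i. i < n \<and> a i \<in> J}" for J
  have idx: "a ` idx J = J" if "J \<subseteq> S" for J
    using that by (auto simp: idx_def S_def)
  have idx_sub: "idx J \<subseteq> {..<n}" and idx_Int: "idx J \<inter> idx K = idx (J \<inter> K)" for J K
    by (auto simp: idx_def)
  have "generate G J \<inter> generate G K = generate G (J \<inter> K)" if "J \<subseteq> S" "K \<subseteq> S" for J K
    using parabolic_Int[OF idx_sub idx_sub, of J K] that idx[of "J \<inter> K"]
    by (simp add: idx idx_Int inf.coboundedI1)
  moreover have "(generate G J <#>\<^bsub>G\<^esub> generate G K) \<inter> (generate G J <#>\<^bsub>G\<^esub> generate G L)
      = generate G J <#>\<^bsub>G\<^esub> (generate G K \<inter> generate G L)"
    if "J \<subseteq> S" "K \<subseteq> S" "L \<subseteq> S" for J K L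
    using parabolic_product_Int[OF idx_sub idx_sub idx_sub, of J K L] that by (simp add: idx)
  ultimately show ?thesis using coset_complex_flag by blast
qed

end
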